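(* Let $\alpha\in(0,1)$ and $k\ge1$. Let $\widetilde{\mathbb{A}}\in\mathbb{R}^{N\times N}$ be a symmetric positive definite matrix with smallest eigenvalue $\lambda_1$, and let $\widetilde f_h\in\mathbb{R}^N$. Put $\widetilde u_h=\widetilde{\mathbb{A}}^{-\alpha}\widetilde f_h$ and $\widetilde w_h=\lambda_1^{-\alpha}r_{\alpha,k}(\lambda_1\widetilde{\mathbb{A}}^{-1})\widetilde f_h$. Then $$\|\widetilde u_h-\widetilde w_h\|_{\ell_2}\le\lambda_1^{-\alpha}E_{\alpha,k}\,\|\widetilde f_h\|_{\ell_2},$$ where $\|\cdot\|_{\ell_2}$ is the Euclidean norm on $\mathbb{R}^N$.
   Context: $\mathcal{R}_k$ denotes the set of rational functions $P(t)/Q(t)$ with $P,Q$ real polynomials of degree at most $k$ and $Q(0)=1$; $r_{\alpha,k}\in\mathcal{R}_k$ is the best uniform rational approximation of $t^\alpha$ on $[0,1]$, i.e. the minimizer of $\|s(t)-t^\alpha\|_{L^\infty[0,1]}$ over $s\in\mathcal{R}_k$, and $E_{\alpha,k}=\|r_{\alpha,k}(t)-t^\alpha\|_{L^\infty[0,1]}$. Functions of the symmetric positive definite matrix $\widetilde{\mathbb{A}}$ (including $\widetilde{\mathbb{A}}^{-\alpha}$ and $r_{\alpha,k}(\lambda_1\widetilde{\mathbb{A}}^{-1})$) are defined through its orthogonal diagonalization. In the paper $\widetilde{\mathbb{A}}$ comes from a finite difference approximation of an elliptic operator and $\widetilde f_h$ is the vector of values of the data at the grid points. *)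

theory Defs
  imports
    "HOL-Analysis.Analysis"
    "HOL-Probability.Essential_Supremum"
    "HOL-Computational_Algebra.Polynomial"
begin

definition spd_matrix :: "real^'n^'n \<Rightarrow> bool" where
  "spd_matrix A \<longleftrightarrow> transpose A = A \<and> (\<forall>x. x \<noteq> 0 \<longrightarrow> 0 < x \<bullet> (A *v x))"

definition eigenvalue :: "real^'n^'n \<Rightarrow> real \<Rightarrow> bool" where
  "eigenvalue A \<mu> \<longleftrightarrow> (\<exists>v. v \<noteq> 0 \<and> A *v v = \<mu> *\<^sub>R v)"

definition smallest_eigenvalue :: "real^'n^'n \<Rightarrow> real \<Rightarrow> bool" where
  "smallest_eigenvalue A \<mu> \<longleftrightarrow> eigenvalue A \<mu> \<and> (\<forall>\<nu>. eigenvalue A \<nu> \<longrightarrow> \<mu> \<le> \<nu>)"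

definition diag_matrix :: "('n \<Rightarrow> real) \<Rightarrow> real^'n^'n" where
  "diag_matrix d = (\<chi> i j. if i = j then d i else 0)"

text \<open>The result does not depend on the chosen orthogonal diagonalization, so the
  description is definite whenever \<open>A\<close> is symmetric; other \<open>A\<close> are irrelevant.\<close>

definition matrix_fun :: "(real \<Rightarrow> real) \<Rightarrow> real^'n^'n \<Rightarrow> real^'n^'n" where
  "matrix_fun g A =
     (THE B. \<exists>U d. orthogonal_matrix U \<and> A = U ** diag_matrix d ** transpose U \<and>
                   B = U ** diag_matrix (\<lambda>i. g (d i)) ** transpose U)"

text \<open>Rational functions are identified with their value functions. Taking \<open>P/Q\<close> in lowest
  terms loses no rational function (a common factor does not vanish at \<open>0\<close> and can be
  normalised away), and it excludes the spurious value \<open>0/0 = 0\<close> at common zeros. At a genuine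
  pole the value is the conventional \<open>0\<close>, but then the function is essentially unbounded
  near that pole.\<close>

definition rational_funs :: "nat \<Rightarrow> (real \<Rightarrow> real) set" where
  "rational_funs k =
     {(\<lambda>t. poly P t / poly Q t) | P Q.
        degree P \<le> k \<and> degree Q \<le> k \<and> poly Q 0 = 1 \<and> coprime P Q}"

definition Linf_norm :: "(real \<Rightarrow> real) \<Rightarrow> ereal" where
  "Linf_norm g = esssup (lebesgue_on {0..1}) (\<lambda>t. ereal \<bar>g t\<bar>)"

definition best_rational_approx :: "real \<Rightarrow> nat \<Rightarrow> (real \<Rightarrow> real) \<Rightarrow> bool" where
  "best_rational_approx \<alpha> k r \<longleftrightarrow>
     is_arg_min (\<lambda>s. Linf_norm (\<lambda>t. s t - t powr \<alpha>)) (\<lambda>s. s \<in> rational_funs k) r"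

text \<open>For \<open>\<alpha> > 0\<close> the zero function is an admissible competitor with error \<open>1\<close>, so the error of
  a best approximation is finite and the conversion to a real number is harmless.\<close>

definition approx_error :: "real \<Rightarrow> (real \<Rightarrow> real) \<Rightarrow> real" where
  "approx_error \<alpha> r = real_of_ereal (Linf_norm (\<lambda>t. r t - t powr \<alpha>))"

end

theory Submission
  imports Defs
begin

text \<open>
  Diagonalise \<open>A = U D U\<^sup>T\<close> with \<open>U\<close> orthogonal. Then \<open>lam1 A\<^sup>-\<^sup>1\<close> is diagonalised by
  the same \<open>U\<close>, with eigenvalues \<open>t = lam1 / d\<close>; since \<open>d \<ge> lam1 > 0\<close>, they lie in
  \<open>{0<..1}\<close>, where \<open>d powr - \<alpha> = lam1 powr - \<alpha> * t powr \<alpha>\<close>. Hence \<open>u - w = U G U\<^sup>T f\<close> with a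
  diagonal \<open>G\<close> whose entries are \<open>lam1 powr - \<alpha> * (t powr \<alpha> - r t)\<close>. Orthogonal matrices are
  isometries, so it suffices to bound the entries of \<open>G\<close>.

  Three points need an argument. A symmetric matrix has an orthogonal diagonalisation
  (\<open>symmetric_matrix_diagonalization\<close>); this comes from maximising the Rayleigh quotient on
  invariant subspaces. The definite description in \<^const>\<open>matrix_fun\<close> needs \<open>g(A)\<close> to be the
  same for all diagonalisations (\<open>matrix_fun_diagonalization\<close>): the orthogonal matrix that takes
  one eigenbasis to another only mixes equal eigenvalues. Finally, the error is an
  essential supremum whereas the eigenvalues form a null set, so the bound is needed
  pointwise (\<open>best_rational_approx_pointwise\<close>). For \<open>r = P / Q\<close> the inequality
  \<open>\<bar>P t - Q t * t powr \<alpha>\<bar> \<le> E * \<bar>Q t\<bar>\<close> is a closed condition that holds almost everywhere, hence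
  everywhere on \<open>{0..1}\<close>. At a zero of \<open>Q\<close> it would force a common zero of \<open>P\<close> and \<open>Q\<close>, so
  coprimality excludes poles and division by \<open>Q\<close> gives the bound on \<open>r\<close>.
\<close>

section \<open>Orthonormal eigenbases of self-adjoint maps\<close>

text \<open>A maximiser \<open>x\<close> of the Rayleigh quotient on the unit sphere of \<open>S\<close> is an eigenvector: with
  \<open>\<mu>\<close> the maximum, \<open>g y = f y - \<mu> y\<close> is self-adjoint with \<open>y \<bullet> g y \<le> 0\<close> on \<open>S\<close> and equality at
  \<open>x\<close>, so the first variation \<open>g x\<close> in the direction \<open>g x \<in> S\<close> vanishes.\<close>

lemma selfadjoint_eigenvector_in_subspace:
  fixes f :: "'a::euclidean_space \<Rightarrow> 'a"
  assumes lin: "linear f" and sa: "\<And>x y. x \<bullet> f y = f x \<bullet> y"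
    and S: "subspace S" and inv: "\<And>x. x \<in> S \<Longrightarrow> f x \<in> S" and ne: "\<exists>x\<in>S. x \<noteq> 0"
  shows "\<exists>x\<in>S. norm x = 1 \<and> (\<exists>\<mu>. f x = \<mu> *\<^sub>R x)"
proof -
  interpret f: linear f by (rule lin)
  let ?K = "sphere 0 1 \<inter> S"
  obtain z where z: "z \<in> S" "z \<noteq> 0" using ne by blast
  have "(1 / norm z) *\<^sub>R z \<in> ?K"
    using z S by (auto simp: subspace_scale)
  then have "?K \<noteq> {}" by blast
  moreover have "compact ?K"
    by (intro compact_Int_closed compact_sphere closed_subspace S)
  moreover have "continuous_on ?K (\<lambda>x. x \<bullet> f x)"
    by (intro continuous_intros linear_continuous_on linear_conv_bounded_linear[THEN iffD1] lin)
  ultimately obtain x where x: "x \<in> ?K" and max: "\<And>y. y \<in> ?K \<Longrightarrow> y \<bullet> f y \<le> x \<bullet> f x"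
    using continuous_attains_sup by (metis (no_types, lifting))
  define \<mu> where "\<mu> = x \<bullet> f x"
  define g where "g y = f y - \<mu> *\<^sub>R y" for y
  have nx: "norm x = 1" "x \<in> S" "x \<bullet> x = 1"
    using x by (auto simp: dot_square_norm)
  have le: "y \<bullet> g y \<le> 0" if "y \<in> S" for y
  proof (cases "y = 0")
    case False
    then have "(1 / norm y) *\<^sub>R y \<in> ?K" using that S by (auto simp: subspace_scale)
    from max[OF this] have "(y \<bullet> f y) / (norm y)\<^sup>2 \<le> \<mu>"
      by (simp add: \<mu>_def f.scale power2_eq_square)
    then have "y \<bullet> f y \<le> \<mu> * (norm y)\<^sup>2" using False by (simp add: divide_simps)
    then show ?thesis by (simp add: g_def inner_diff_right dot_square_norm)
  qed (simp add: g_def)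
  have gS: "g x \<in> S" using nx inv S by (auto simp: g_def subspace_diff subspace_scale)
  define a where "a = g x \<bullet> g x"
  define b where "b = g x \<bullet> g (g x)"
  have quad: "2 * s * a + s\<^sup>2 * b \<le> 0" for s
  proof -
    have "x + s *\<^sub>R g x \<in> S" using nx gS S by (auto simp: subspace_add subspace_scale)
    from le[OF this] have "(x + s *\<^sub>R g x) \<bullet> g (x + s *\<^sub>R g x) \<le> 0" .
    moreover have "g (x + s *\<^sub>R g x) = g x + s *\<^sub>R g (g x)"
      by (simp add: g_def f.add f.scale f.diff algebra_simps)
    moreover have "x \<bullet> g x = 0" using nx by (simp add: g_def inner_diff_right \<mu>_def)
    moreover have "x \<bullet> g (g x) = g x \<bullet> g x"
      using sa[of x "g x"] by (simp only: g_def[of "g x"] inner_diff_right)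
        (simp add: g_def inner_diff_left)
    ultimately show ?thesis
      by (simp add: a_def b_def inner_add_left inner_add_right power2_eq_square algebra_simps)
  qed
  have "a \<le> 0"
  proof (rule ccontr)
    assume "\<not> a \<le> 0"
    then have a: "a > 0" by simp
    \<comment> \<open>a step so small that the quadratic term is at most half of the linear one\<close>
    define s where "s = a / (1 + \<bar>b\<bar>)"
    have s: "s > 0" using a by (simp add: s_def add_pos_nonneg)
    have "s * \<bar>b\<bar> \<le> a" using a by (simp add: s_def pos_divide_le_eq add_pos_nonneg algebra_simps)
    moreover have "s * (- \<bar>b\<bar>) \<le> s * b" using s by (intro mult_left_mono) auto
    ultimately have "- a \<le> s * b" by simp
    then have "0 < 2 * a + s * b" using a by linarith
    then have "0 < s * (2 * a + s * b)" using s by simp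
    then show False using quad[of s] by (simp add: algebra_simps power2_eq_square)
  qed
  then have "g x = 0" unfolding a_def using inner_gt_zero_iff[of "g x"] by linarith
  then show ?thesis using nx by (auto simp: g_def)
qed

lemma selfadjoint_orthonormal_eigenbasis:
  fixes f :: "'a::euclidean_space \<Rightarrow> 'a"
  assumes lin: "linear f" and sa: "\<And>x y. x \<bullet> f y = f x \<bullet> y" and "n \<le> DIM('a)"
  shows "\<exists>B. finite B \<and> card B = n \<and> pairwise orthogonal B \<and>
    (\<forall>b\<in>B. norm b = 1 \<and> (\<exists>\<mu>. f b = \<mu> *\<^sub>R b))"
  using \<open>n \<le> DIM('a)\<close>
proof (induction n)
  case 0
  then show ?case by (intro exI[of _ "{}"]) auto
next
  case (Suc n)
  then obtain B where B: "finite B" "card B = n" "pairwise orthogonal B"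
    "\<And>b. b \<in> B \<Longrightarrow> norm b = 1" "\<And>b. b \<in> B \<Longrightarrow> \<exists>\<mu>. f b = \<mu> *\<^sub>R b" by auto
  \<comment> \<open>the orthogonal complement of eigenvectors is invariant, so it holds a further one\<close>
  define S where "S = {x. \<forall>b\<in>B. x \<bullet> b = 0}"
  have "subspace S" by (auto simp: S_def subspace_def inner_add_left)
  moreover have "f x \<in> S" if "x \<in> S" for x
    unfolding S_def
  proof safe
    fix b assume b: "b \<in> B"
    then obtain \<mu> where "f b = \<mu> *\<^sub>R b" using B by blast
    then show "f x \<bullet> b = 0" using that b sa[of x b] by (simp add: S_def)
  qed
  moreover have "\<exists>x\<in>S. x \<noteq> 0"
  proof -
    have "dim B < DIM('a)"
      using dim_le_card'[OF B(1)] B(2) Suc.prems by linarith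
    then obtain x where "x \<noteq> 0" "\<And>y. y \<in> span B \<Longrightarrow> orthogonal x y"
      using orthogonal_to_subspace_exists by blast
    then have "x \<in> S" by (auto simp: S_def orthogonal_def span_base)
    then show ?thesis using \<open>x \<noteq> 0\<close> by blast
  qed
  ultimately obtain x \<mu> where x: "x \<in> S" "norm x = 1" "f x = \<mu> *\<^sub>R x"
    using selfadjoint_eigenvector_in_subspace[OF lin sa] by blast
  have "x \<notin> B" using x by (auto simp: S_def)
  moreover have "pairwise orthogonal (insert x B)"
    using B(3) x(1) by (auto simp: pairwise_insert S_def orthogonal_def inner_commute)
  ultimately show ?case
    using B x by (intro exI[of _ "insert x B"]) auto
qed

section \<open>Orthogonal diagonalisation and functions of a matrix\<close>

lemma diag_matrix_mult_left: "(diag_matrix d ** M) $ i $ j = d i * M $ i $ j"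
  by (simp add: diag_matrix_def matrix_matrix_mult_def if_distrib[of "\<lambda>x. x * _"] cong: if_cong)

lemma diag_matrix_mult_right: "(M ** diag_matrix d) $ i $ j = M $ i $ j * d j"
  by (simp add: diag_matrix_def matrix_matrix_mult_def if_distrib[of "\<lambda>x. _ * x"] cong: if_cong)

lemma diag_matrix_mult_vec: "(diag_matrix d *v x) $ i = d i * x $ i"
  by (simp add: diag_matrix_def matrix_vector_mult_def if_distrib[of "\<lambda>x. x * _"] cong: if_cong)

lemma symmetric_matrix_diagonalization:
  fixes A :: "real^'n^'n"
  assumes "transpose A = A"
  shows "\<exists>U d. orthogonal_matrix U \<and> A = U ** diag_matrix d ** transpose U"
proof -
  have "x \<bullet> (A *v y) = (A *v x) \<bullet> y" for x y
    by (metis assms dot_lmul_matrix vector_transpose_matrix)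
  from selfadjoint_orthonormal_eigenbasis[OF matrix_vector_mul_linear[of A] this order_refl]
  obtain B where B: "finite B" "card B = CARD('n)" "pairwise orthogonal B"
    "\<And>b. b \<in> B \<Longrightarrow> norm b = 1" "\<And>b. b \<in> B \<Longrightarrow> \<exists>\<mu>. A *v b = \<mu> *\<^sub>R b" by auto
  obtain h :: "'n \<Rightarrow> real^'n" where h: "bij_betw h UNIV B"
    using finite_same_card_bij[OF finite[of "UNIV :: 'n set"] B(1)] B(2) by auto
  have hB: "h i \<in> B" for i using h by (auto simp: bij_betw_def)
  obtain d where d: "\<And>i. A *v h i = d i *\<^sub>R h i" using B(5)[OF hB] by metis
  define U :: "real^'n^'n" where "U = (\<chi> i j. h j $ i)"
  have col: "column i U = h i" for i by (simp add: U_def column_def vec_eq_iff)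
  have U: "orthogonal_matrix U"
    unfolding orthogonal_matrix_orthonormal_columns col
    using B(3,4) hB h by (auto simp: pairwise_def bij_betw_def inj_eq)
  have "(A ** U) $ i $ j = (A *v h j) $ i" for i j
    by (simp add: matrix_matrix_mult_def matrix_vector_mult_def U_def)
  then have "A ** U = U ** diag_matrix d"
    by (simp add: vec_eq_iff diag_matrix_mult_right d) (simp add: U_def)
  then have "A = U ** diag_matrix d ** transpose U"
    using U by (metis matrix_mul_assoc matrix_mul_rid orthogonal_matrix_def)
  then show ?thesis using U by blast
qed

text \<open>The transition matrix \<open>W = V\<^sup>T U\<close> intertwines the two diagonal matrices, so that
  \<open>W\<^sub>i\<^sub>j \<noteq> 0\<close> forces \<open>c\<^sub>j = d\<^sub>i\<close>; hence it also intertwines their images under \<open>g\<close>.\<close>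

lemma matrix_fun_diagonalization_unique:
  fixes U V :: "real^'n^'n"
  assumes U: "orthogonal_matrix U" and V: "orthogonal_matrix V"
    and eq: "U ** diag_matrix c ** transpose U = V ** diag_matrix d ** transpose V"
  shows "U ** diag_matrix (\<lambda>i. g (c i)) ** transpose U = V ** diag_matrix (\<lambda>i. g (d i)) ** transpose V"
proof -
  define W where "W = transpose V ** U"
  have UU: "transpose U ** U = mat 1" "U ** transpose U = mat 1"
    and VV: "transpose V ** V = mat 1" "V ** transpose V = mat 1"
    using U V by (auto simp: orthogonal_matrix_def)
  have "W ** diag_matrix c = transpose V ** (U ** diag_matrix c ** transpose U) ** U"
    by (metis W_def UU(1) matrix_mul_assoc matrix_mul_rid)
  also have "\<dots> = diag_matrix d ** W"
    by (metis eq W_def VV(1) matrix_mul_assoc matrix_mul_lid)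
  finally have "W ** diag_matrix c = diag_matrix d ** W" .
  then have "W $ i $ j * c j = d i * W $ i $ j" for i j
    by (metis diag_matrix_mult_left diag_matrix_mult_right)
  then have "W $ i $ j = 0 \<or> c j = d i" for i j
    by (metis mult.commute mult_left_cancel)
  then have "W $ i $ j * g (c j) = g (d i) * W $ i $ j" for i j
    by (metis mult.commute mult_zero_left)
  then have W: "W ** diag_matrix (\<lambda>i. g (c i)) = diag_matrix (\<lambda>i. g (d i)) ** W"
    by (simp add: vec_eq_iff diag_matrix_mult_left diag_matrix_mult_right)
  have VW: "V ** W = U" by (metis W_def VV(2) matrix_mul_assoc matrix_mul_lid)
  have WU: "W ** transpose U = transpose V" by (metis W_def UU(2) matrix_mul_assoc matrix_mul_rid)
  show ?thesis by (metis VW WU W matrix_mul_assoc)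
qed

lemma matrix_fun_diagonalization:
  assumes "orthogonal_matrix U" and "A = U ** diag_matrix d ** transpose U"
  shows "matrix_fun g A = U ** diag_matrix (\<lambda>i. g (d i)) ** transpose U"
  unfolding matrix_fun_def
proof (rule the_equality)
  fix B
  assume "\<exists>V c. orthogonal_matrix V \<and> A = V ** diag_matrix c ** transpose V \<and>
    B = V ** diag_matrix (\<lambda>i. g (c i)) ** transpose V"
  then show "B = U ** diag_matrix (\<lambda>i. g (d i)) ** transpose U"
    using matrix_fun_diagonalization_unique[of _ U] assms by metis
qed (use assms in blast)

lemma eigenvalue_diagonalization:
  assumes U: "orthogonal_matrix U" and A: "A = U ** diag_matrix d ** transpose U"
  shows "eigenvalue A (d i)"
proof -
  have UU: "transpose U ** U = mat 1" using U by (simp add: orthogonal_matrix_def)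
  have D: "diag_matrix d *v axis i 1 = d i *\<^sub>R axis i 1"
    by (simp add: vec_eq_iff diag_matrix_mult_vec axis_def)
  have "A *v (U *v axis i 1) = U *v (diag_matrix d *v ((transpose U ** U) *v axis i 1))"
    by (simp add: A matrix_vector_mul_assoc matrix_mul_assoc)
  also have "\<dots> = d i *\<^sub>R (U *v axis i 1)"
    by (simp add: UU D matrix_vector_mult_scaleR)
  finally have "A *v (U *v axis i 1) = d i *\<^sub>R (U *v axis i 1)" .
  moreover have "U *v axis i 1 \<noteq> 0"
    by (metis UU axis_eq_0_iff matrix_vector_mul_assoc matrix_vector_mul_lid
        matrix_vector_mult_0_right zero_neq_one)
  ultimately show ?thesis unfolding eigenvalue_def by blast
qed

lemma matrix_inv_diagonalization:
  assumes U: "orthogonal_matrix U" and A: "A = U ** diag_matrix d ** transpose U"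
    and d: "\<And>i. d i \<noteq> 0"
  shows "matrix_inv A = U ** diag_matrix (\<lambda>i. 1 / d i) ** transpose U"
proof -
  let ?B = "U ** diag_matrix (\<lambda>i. 1 / d i) ** transpose U"
  have UU: "transpose U ** U = mat 1" "U ** transpose U = mat 1"
    using U by (auto simp: orthogonal_matrix_def)
  have DD: "diag_matrix d ** diag_matrix (\<lambda>i. 1 / d i) = mat 1"
    by (simp add: vec_eq_iff diag_matrix_mult_left) (simp add: diag_matrix_def mat_def d)
  have AB: "A ** ?B = mat 1"
    by (metis A UU DD matrix_mul_assoc matrix_mul_rid)
  then have "?B ** A = mat 1" by (simp add: matrix_left_right_inverse)
  with AB have "invertible A" unfolding invertible_def by blast
  then have "matrix_inv A ** A = mat 1"
    unfolding matrix_inv_def invertible_def by (rule someI2_ex) simp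
  then show ?thesis by (metis AB matrix_mul_assoc matrix_mul_lid matrix_mul_rid)
qed

lemma scaleR_diagonalization:
  "c *\<^sub>R (U ** diag_matrix d ** transpose U) = U ** diag_matrix (\<lambda>i. c * d i) ** transpose U"
  by (simp add: vec_eq_iff matrix_matrix_mult_def[of _ "transpose U"] diag_matrix_mult_right
      sum_distrib_left mult.assoc mult.left_commute)

lemma diff_diagonalization:
  "U ** diag_matrix c ** transpose U - U ** diag_matrix d ** transpose U
    = U ** diag_matrix (\<lambda>i. c i - d i) ** transpose U"
  by (simp add: vec_eq_iff matrix_matrix_mult_def[of _ "transpose U"] diag_matrix_mult_right
      sum_subtractf algebra_simps)

lemma norm_diagonalized_mult_le:
  fixes U :: "real^'n^'n"
  assumes U: "orthogonal_matrix U" and d: "\<And>i. \<bar>d i\<bar> \<le> c"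
  shows "norm ((U ** diag_matrix d ** transpose U) *v x) \<le> c * norm x"
proof -
  have iso: "norm (V *v y) = norm y" if "orthogonal_matrix V" for V :: "real^'n^'n" and y
    using that by (metis matrix_of_matrix_vector_mul matrix_vector_mul_linear
        orthogonal_transformation orthogonal_transformation_matrix)
  let ?y = "transpose U *v x"
  have c: "c \<ge> 0" using d[of undefined] by linarith
  have "norm ((U ** diag_matrix d ** transpose U) *v x) = norm (diag_matrix d *v ?y)"
    using iso[OF U] by (simp add: matrix_vector_mul_assoc[symmetric])
  also have "\<dots> \<le> norm (c *\<^sub>R ?y)"
    using c by (intro norm_le_componentwise_cart)
      (auto simp: diag_matrix_mult_vec abs_mult intro!: mult_right_mono d)
  also have "\<dots> = c * norm x" using c iso[of "transpose U" x] U by simp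
  finally show ?thesis .
qed

section \<open>From the essential supremum to a pointwise bound\<close>

text \<open>The extended norm of the error is an honest real number: it is at most \<open>1\<close> by comparison
  with the zero function, and nonnegative because \<open>{0..1}\<close> is not a null set.\<close>

lemma Linf_norm_best_rational_approx:
  assumes \<alpha>: "0 < \<alpha>" and best: "best_rational_approx \<alpha> k r"
  shows "Linf_norm (\<lambda>t. r t - t powr \<alpha>) = ereal (approx_error \<alpha> r)"
proof -
  let ?L = "Linf_norm (\<lambda>t. r t - t powr \<alpha>)"
  have ae: "AE t in lebesgue_on {0..1::real}. 0 \<le> t \<and> t \<le> 1"
    by (rule AE_I2) simp
  have "(\<lambda>t. poly 0 t / poly 1 t) \<in> rational_funs k"
    unfolding rational_funs_def by (intro CollectI exI[of _ 0] exI[of _ 1]) auto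
  then have "(\<lambda>t. 0) \<in> rational_funs k" by simp
  then have "?L \<le> Linf_norm (\<lambda>t. 0 - t powr \<alpha>)"
    using best unfolding best_rational_approx_def is_arg_min_def by (meson not_less)
  also have "\<dots> \<le> 1"
    unfolding Linf_norm_def
  proof (rule esssup_I)
    show "(\<lambda>t. ereal \<bar>0 - t powr \<alpha>\<bar>) \<in> borel_measurable (lebesgue_on {0..1})"
      by (intro measurable_restrict_space1 measurable_completion) simp
    show "AE t in lebesgue_on {0..1}. ereal \<bar>0 - t powr \<alpha>\<bar> \<le> 1"
      using ae by eventually_elim (use \<alpha> in \<open>auto simp: powr_le1\<close>)
  qed
  finally have "?L \<le> 1" .
  moreover have "0 \<le> ?L"
  proof -
    have "emeasure (lebesgue_on {0..1::real}) (space (lebesgue_on {0..1})) \<noteq> 0"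
      by (simp add: emeasure_restrict_space)
    then have "esssup (lebesgue_on {0..1::real}) (\<lambda>t. 0::ereal) = 0"
      by (rule esssup_const)
    moreover have "esssup (lebesgue_on {0..1::real}) (\<lambda>t. 0::ereal) \<le> ?L"
      unfolding Linf_norm_def by (rule esssup_mono) auto
    ultimately show ?thesis by simp
  qed
  ultimately have "\<bar>?L\<bar> \<noteq> \<infinity>" by auto
  then show ?thesis unfolding approx_error_def by (simp add: ereal_real)
qed

text \<open>Working with \<open>P - Q * t powr \<alpha>\<close>, which is continuous, avoids having to know beforehand where
  \<open>r\<close> is continuous; the absence of poles in \<open>{0..1}\<close> then comes out of the same inequality.\<close>

lemma best_rational_approx_pointwise:
  assumes \<alpha>: "0 < \<alpha>" and best: "best_rational_approx \<alpha> k r" and t: "t \<in> {0..1}"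
  shows "\<bar>r t - t powr \<alpha>\<bar> \<le> approx_error \<alpha> r"
proof -
  define E where "E = approx_error \<alpha> r"
  obtain P Q where r: "r = (\<lambda>t. poly P t / poly Q t)" and Q0: "poly Q 0 = 1" and co: "coprime P Q"
    using best unfolding best_rational_approx_def is_arg_min_def rational_funs_def by auto
  define C where "C = {s \<in> {0..1}. \<bar>poly P s - poly Q s * s powr \<alpha>\<bar> \<le> E * \<bar>poly Q s\<bar>}"
  have closed: "closed C"
    unfolding C_def
    by (intro continuous_on_closed_Collect_le continuous_intros continuous_on_powr')
      (use \<alpha> in auto)
  have "AE s in lebesgue_on {0..1}. \<bar>r s - s powr \<alpha>\<bar> \<le> E"
    using esssup_AE[of "\<lambda>s. ereal \<bar>r s - s powr \<alpha>\<bar>" "lebesgue_on {0..1}"]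
      Linf_norm_best_rational_approx[OF \<alpha> best] by (simp add: Linf_norm_def E_def)
  then have ae: "AE s in lebesgue. s \<in> {0..1} \<longrightarrow> \<bar>r s - s powr \<alpha>\<bar> \<le> E"
    by (simp add: AE_restrict_space_iff)
  have "Q \<noteq> 0" using Q0 by auto
  then have "finite {s. poly Q s = 0}" by (rule poly_roots_finite)
  then have "{s. poly Q s = 0} \<in> null_sets lebesgue"
    by (intro null_sets_completionI finite_imp_null_set_lborel)
  from AE_not_in[OF this] ae have "AE s in lebesgue. s \<in> {0<..<1} \<longrightarrow> s \<in> C"
  proof eventually_elim
    case (elim s)
    then have q: "poly Q s \<noteq> 0" by simp
    show ?case
    proof
      assume s: "s \<in> {0<..<1}"
      have "poly P s - poly Q s * s powr \<alpha> = (r s - s powr \<alpha>) * poly Q s"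
        using q by (simp add: r left_diff_distrib)
      then have "\<bar>poly P s - poly Q s * s powr \<alpha>\<bar> = \<bar>r s - s powr \<alpha>\<bar> * \<bar>poly Q s\<bar>"
        by (simp only: abs_mult)
      also have "\<dots> \<le> E * \<bar>poly Q s\<bar>" using elim s by (intro mult_right_mono) auto
      finally show "s \<in> C" using s by (simp add: C_def)
    qed
  qed
  then have "{0<..<1} \<subseteq> C"
    using mem_closed_if_AE_lebesgue_open[OF open_greaterThanLessThan closed] by blast
  then have "closure {0<..<1} \<subseteq> C" by (rule closure_minimal[OF _ closed])
  then have "t \<in> C" using t by auto
  then have le: "\<bar>poly P t - poly Q t * t powr \<alpha>\<bar> \<le> E * \<bar>poly Q t\<bar>" by (simp add: C_def)
  have q: "poly Q t \<noteq> 0"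
  proof
    assume q: "poly Q t = 0"
    with le have "poly P t = 0" by simp
    with q have "[:- t, 1:] dvd P" "[:- t, 1:] dvd Q" by (simp_all add: poly_eq_0_iff_dvd)
    with co have "is_unit [:- t, 1:]" by (rule coprime_common_divisor)
    then show False by (simp add: is_unit_iff_degree)
  qed
  have "\<bar>r t - t powr \<alpha>\<bar> = \<bar>poly P t - poly Q t * t powr \<alpha>\<bar> / \<bar>poly Q t\<bar>"
    using q by (simp add: r abs_divide[symmetric] diff_divide_distrib)
  also have "\<dots> \<le> E" using le q by (simp add: divide_simps)
  finally show ?thesis by (simp add: E_def)
qed

section \<open>The error estimate\<close>

theorem mainTheorem4:
  fixes A :: "real^'n^'n" and f u w :: "real^'n"
    and \<alpha> lam1 E :: real and k :: nat and r :: "real \<Rightarrow> real"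
  assumes "0 < \<alpha>" and "\<alpha> < 1" and "k \<ge> 1"
    and "spd_matrix A" and "smallest_eigenvalue A lam1"
    and "best_rational_approx \<alpha> k r"
    and "E = approx_error \<alpha> r"
    and "u = matrix_fun (\<lambda>t. t powr (- \<alpha>)) A *v f"
    and "w = (lam1 powr (- \<alpha>)) *\<^sub>R (matrix_fun r (lam1 *\<^sub>R matrix_inv A) *v f)"
  shows "norm (u - w) \<le> lam1 powr (- \<alpha>) * E * norm f"
proof -
  obtain v where v: "v \<noteq> 0" "A *v v = lam1 *\<^sub>R v"
    using assms(5) by (auto simp: smallest_eigenvalue_def eigenvalue_def)
  have "0 < v \<bullet> (A *v v)" using assms(4) v(1) by (auto simp: spd_matrix_def)
  then have "0 < lam1 * (v \<bullet> v)" by (simp add: v)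
  then have lam1: "0 < lam1" by (rule zero_less_mult_pos2) (simp add: v)
  obtain U d where U: "orthogonal_matrix U" and A: "A = U ** diag_matrix d ** transpose U"
    using symmetric_matrix_diagonalization assms(4) unfolding spd_matrix_def by blast
  have d: "lam1 \<le> d i" for i
    using eigenvalue_diagonalization[OF U A] assms(5) by (simp add: smallest_eigenvalue_def)
  then have d0: "0 < d i" for i using lam1 by (meson less_le_trans)
  define c where "c = lam1 powr (- \<alpha>)"
  have "lam1 *\<^sub>R matrix_inv A = U ** diag_matrix (\<lambda>i. lam1 * (1 / d i)) ** transpose U"
    using matrix_inv_diagonalization[OF U A] d0 by (simp add: less_imp_neq[symmetric] scaleR_diagonalization)
  from matrix_fun_diagonalization[OF U this]
  have "w = c *\<^sub>R ((U ** diag_matrix (\<lambda>i. r (lam1 / d i)) ** transpose U) *v f)"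
    by (simp add: assms(9) c_def)
  also have "\<dots> = (U ** diag_matrix (\<lambda>i. c * r (lam1 / d i)) ** transpose U) *v f"
    by (simp only: scaleR_diagonalization[symmetric] scaleR_matrix_vector_assoc)
  finally have w: "w = (U ** diag_matrix (\<lambda>i. c * r (lam1 / d i)) ** transpose U) *v f" .
  have u: "u = (U ** diag_matrix (\<lambda>i. d i powr (- \<alpha>)) ** transpose U) *v f"
    by (simp add: assms(8) matrix_fun_diagonalization[OF U A])
  have "u - w = (U ** diag_matrix (\<lambda>i. d i powr (- \<alpha>) - c * r (lam1 / d i)) ** transpose U) *v f"
    by (simp only: u w matrix_vector_mult_diff_rdistrib[symmetric] diff_diagonalization)
  also have "norm \<dots> \<le> c * E * norm f"
  proof (rule norm_diagonalized_mult_le[OF U])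
    fix i
    have "d i powr (- \<alpha>) = c * (lam1 / d i) powr \<alpha>"
      using lam1 d0[of i] by (simp add: c_def powr_divide powr_minus divide_simps)
    then have "\<bar>d i powr (- \<alpha>) - c * r (lam1 / d i)\<bar> = c * \<bar>r (lam1 / d i) - (lam1 / d i) powr \<alpha>\<bar>"
      by (simp add: c_def right_diff_distrib[symmetric] abs_mult abs_minus_commute)
    also have "\<dots> \<le> c * E"
      using best_rational_approx_pointwise[OF assms(1,6), of "lam1 / d i"] lam1 d[of i] d0[of i]
      by (intro mult_left_mono) (auto simp: c_def assms(7))
    finally show "\<bar>d i powr (- \<alpha>) - c * r (lam1 / d i)\<bar> \<le> c * E" .
  qed
  finally show ?thesis by (simp add: c_def)
qed

end
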